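(* Let $S$ be a monoid with zero and let $A,A_1,A_2$ be pairwise isomorphic acts in the category $S\text{-}\mathrm{Act}_0$. The following conditions are equivalent: (1) $A$ is not autoconnected in $S\text{-}\mathrm{Act}_0$; (2) there exist a pair $B_1,B_2$ of proper subacts of $A$ satisfying $A=B_1\cup B_2$ and a morphism $f:B_1\sqcup B_2\to A_1\sqcup A_2$ such that $\pi_i f(B_1\sqcup B_2)\ne\{0_{A_i}\}$ for $i=1,2$ and $\ker\rho_{B_1B_2}\subseteq\ker f$.
   Context: Let $S$ be a monoid with a zero element $0$. A pointed left $S$-act is a set $A$ with a map $S\times A\to A$, $(s,a)\mapsto sa$, satisfying $1a=a$ and $s_2(s_1a)=(s_2s_1)a$, together with a fixed element $0_A\in A$ such that $0a=0_A$ for each $a\in A$. $S\text{-}\mathrm{Act}_0$ is the category of pointed left $S$-acts with maps $f:A\to B$ satisfying $f(sa)=sf(a)$ and $f(0_A)=0_B$. Its initial object is $\{0\}$, and coproducts are $\coprod_{i\in I}A_i=\{(a_i)\in\prod_{i\in I}A_i\mid \exists j\ \forall i\neq j:\ a_i=0\}$ (disjoint unions with zeros glued together). Subacts of a pointed act contain the zero. An object $C$ is autoconnected if for every nonempty family $(C_i,i\in I)$ with $C_i=C$ for all $i$, every morphism $C\to\coprod_{i\in I}C_i$ factors through some coproduct structural morphism $\nu_i:C_i\to\coprod_{i\in I}C_i$. $\pi_i:A_1\sqcup A_2\to A_i$, $i=1,2$, are the canonical projections. For subacts $B_1,B_2$ of $A$ with inclusions $\iota_i:B_i\to A$, $\rho_{B_1B_2}:B_1\sqcup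 B_2\to A$ is the unique morphism with $\rho_{B_1B_2}\nu_i=\iota_i$ for $i=1,2$, where $\nu_i:B_i\to B_1\sqcup B_2$ are the coproduct structural morphisms. For a morphism $g$ with domain $X$, $\ker g=\{(x,y)\in X\times X\mid g(x)=g(y)\}$ is its kernel congruence. *)

theory Defs
  imports "HOL-Algebra.Group" "HOL-Library.FuncSet"
begin

section \<open>Pointed acts over a monoid with zero\<close>

locale monoid_with_zero = monoid S for S :: "('s, 'm) monoid_scheme" (structure) +
  fixes z :: 's
  assumes zero_closed: "z \<in> carrier S"
    and zero_left: "s \<in> carrier S \<Longrightarrow> z \<otimes> s = z"
    and zero_right: "s \<in> carrier S \<Longrightarrow> s \<otimes> z = z"

record ('s, 'a) act = "'a partial_object" +
  action :: "'s \<Rightarrow> 'a \<Rightarrow> 'a"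
  basept :: 'a

locale pointed_act = monoid_with_zero S z
  for S :: "('s, 'm) monoid_scheme" (structure) and z :: 's +
  fixes A :: "('s, 'a) act"
  assumes action_closed: "\<lbrakk>s \<in> carrier S; a \<in> carrier A\<rbrakk> \<Longrightarrow> action A s a \<in> carrier A"
    and action_one: "a \<in> carrier A \<Longrightarrow> action A \<one> a = a"
    and action_mult: "\<lbrakk>s \<in> carrier S; t \<in> carrier S; a \<in> carrier A\<rbrakk>
      \<Longrightarrow> action A t (action A s a) = action A (t \<otimes> s) a"
    and basept_closed: "basept A \<in> carrier A"
    and action_zero: "a \<in> carrier A \<Longrightarrow> action A z a = basept A"

text \<open>As for \<^const>\<open>hom\<close>, only the values of a morphism on the carrier matter.\<close>

definition act_hom :: "('s, 'm) monoid_scheme \<Rightarrow> ('s, 'a) act \<Rightarrow> ('s, 'b) act \<Rightarrow> ('a \<Rightarrow> 'b) set"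
  where "act_hom S A B =
    {f \<in> carrier A \<rightarrow> carrier B.
      (\<forall>s\<in>carrier S. \<forall>a\<in>carrier A. f (action A s a) = action B s (f a)) \<and>
      f (basept A) = basept B}"

definition act_isomorphic :: "('s, 'm) monoid_scheme \<Rightarrow> ('s, 'a) act \<Rightarrow> ('s, 'b) act \<Rightarrow> bool"
  where "act_isomorphic S A B \<longleftrightarrow>
    (\<exists>f\<in>act_hom S A B. \<exists>g\<in>act_hom S B A.
      (\<forall>a\<in>carrier A. g (f a) = a) \<and> (\<forall>b\<in>carrier B. f (g b) = b))"

definition subact :: "('s, 'm) monoid_scheme \<Rightarrow> ('s, 'a) act \<Rightarrow> 'a set \<Rightarrow> bool"
  where "subact S A B \<longleftrightarrow>
    B \<subseteq> carrier A \<and> basept A \<in> B \<and> (\<forall>s\<in>carrier S. \<forall>b\<in>B. action A s b \<in> B)"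

abbreviation restrict_act :: "('s, 'a) act \<Rightarrow> 'a set \<Rightarrow> ('s, 'a) act"
  where "restrict_act A B \<equiv> A\<lparr>carrier := B\<rparr>"

definition act_ker :: "('s, 'a) act \<Rightarrow> ('a \<Rightarrow> 'b) \<Rightarrow> ('a \<times> 'a) set"
  where "act_ker X g = {(x, y) \<in> carrier X \<times> carrier X. g x = g y}"


section \<open>Coproducts\<close>

text \<open>The index \<open>j\<close> is not required to lie in \<open>I\<close>, so that the empty coproduct is the
  initial object; for nonempty \<open>I\<close> this makes no difference.\<close>

definition act_coprod :: "'i set \<Rightarrow> ('i \<Rightarrow> ('s, 'a) act) \<Rightarrow> ('s, 'i \<Rightarrow> 'a) act"
  where "act_coprod I A =
    \<lparr>carrier = {a \<in> \<Pi>\<^sub>E i\<in>I. carrier (A i). \<exists>j. \<forall>i\<in>I. i \<noteq> j \<longrightarrow> a i = basept (A i)},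
     action = (\<lambda>s a. \<lambda>i\<in>I. action (A i) s (a i)),
     basept = (\<lambda>i\<in>I. basept (A i))\<rparr>"

definition act_inj :: "'i set \<Rightarrow> ('i \<Rightarrow> ('s, 'a) act) \<Rightarrow> 'i \<Rightarrow> 'a \<Rightarrow> ('i \<Rightarrow> 'a)"
  where "act_inj I A i x = (\<lambda>k\<in>I. if k = i then x else basept (A k))"

text \<open>The coproduct of two acts is the same construction, written with pairs so that the two
  acts may have different carrier types; its projections are \<^const>\<open>fst\<close> and \<^const>\<open>snd\<close>.\<close>

definition act_coprod2 :: "('s, 'a) act \<Rightarrow> ('s, 'b) act \<Rightarrow> ('s, 'a \<times> 'b) act" (infixr \<open>\<squnion>\<^sub>a\<close> 65)
  where "A \<squnion>\<^sub>a B =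
    \<lparr>carrier = {(x, y) \<in> carrier A \<times> carrier B. x = basept A \<or> y = basept B},
     action = (\<lambda>s (x, y). (action A s x, action B s y)),
     basept = (basept A, basept B)\<rparr>"

definition act_inl :: "('s, 'b) act \<Rightarrow> 'a \<Rightarrow> 'a \<times> 'b"
  where "act_inl B x = (x, basept B)"

definition act_inr :: "('s, 'a) act \<Rightarrow> 'b \<Rightarrow> 'a \<times> 'b"
  where "act_inr A y = (basept A, y)"

text \<open>The morphism \<open>\<rho>\<close> from the coproduct of two subacts of \<open>A\<close> to \<open>A\<close>; the lemmas
  \<open>act_rho_hom\<close>, \<open>act_rho_inl\<close>, \<open>act_rho_inr\<close> and \<open>act_rho_unique\<close> give its universal property.\<close>

definition act_rho :: "('s, 'a) act \<Rightarrow> 'a \<times> 'a \<Rightarrow> 'a"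
  where "act_rho A = (\<lambda>(x, y). if y = basept A then x else y)"

lemma (in pointed_act) action_basept:
  assumes "s \<in> carrier S"
  shows "action A s (basept A) = basept A"
  by (metis assms action_mult action_zero basept_closed zero_closed zero_right)

lemma (in pointed_act) act_rho_hom:
  assumes "subact S A B1" "subact S A B2"
  shows "act_rho A \<in> act_hom S (restrict_act A B1 \<squnion>\<^sub>a restrict_act A B2) A"
  using assms
  by (auto simp: act_hom_def act_coprod2_def act_rho_def subact_def action_basept)

lemma act_rho_inl: "act_rho A (act_inl (restrict_act A B2) x) = x"
  by (simp add: act_rho_def act_inl_def)

lemma act_rho_inr: "act_rho A (act_inr (restrict_act A B1) y) = y"
  by (simp add: act_rho_def act_inr_def)

lemma act_rho_unique:
  assumes "\<And>x. x \<in> B1 \<Longrightarrow> r (act_inl (restrict_act A B2) x) = x"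
    and "\<And>y. y \<in> B2 \<Longrightarrow> r (act_inr (restrict_act A B1) y) = y"
    and "p \<in> carrier (restrict_act A B1 \<squnion>\<^sub>a restrict_act A B2)"
  shows "r p = act_rho A p"
  using assms by (auto simp: act_coprod2_def act_rho_def act_inl_def act_inr_def)


section \<open>Autoconnected acts\<close>

text \<open>Index sets are drawn from a type \<open>'i\<close>, since a definition cannot quantify over all types.
  By \<open>autoconnected_index_type\<close> below, any \<open>'i\<close> with at least two elements yields the same
  notion; over a one-element type it would hold of every act.\<close>

definition autoconnected :: "'i itself \<Rightarrow> ('s, 'm) monoid_scheme \<Rightarrow> ('s, 'a) act \<Rightarrow> bool"
  where "autoconnected T S C \<longleftrightarrow>
    (\<forall>I :: 'i set. I \<noteq> {} \<longrightarrow>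
      (\<forall>f \<in> act_hom S C (act_coprod I (\<lambda>_. C)).
        \<exists>i\<in>I. \<exists>g \<in> act_hom S C C. \<forall>c\<in>carrier C. f c = act_inj I (\<lambda>_. C) i (g c)))"

lemma (in pointed_act) autoconnected_index_type:
  assumes two: "\<exists>p q :: 'i. p \<noteq> q"
    and auto: "autoconnected TYPE('i) S A"
  shows "autoconnected TYPE('j) S A"
  unfolding autoconnected_def
proof (intro allI impI ballI)
  fix J :: "'j set" and f
  assume J: "J \<noteq> {}" and f: "f \<in> act_hom S A (act_coprod J (\<lambda>_. A))"
  obtain p q :: 'i where pq: "p \<noteq> q" using two by blast
  have fc: "f c \<in> carrier (act_coprod J (\<lambda>_. A))" if "c \<in> carrier A" for c
    using f that by (auto simp: act_hom_def)
  have fA: "f c k \<in> carrier A" if "c \<in> carrier A" "k \<in> J" for c k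
    using fc[OF that(1)] that(2) by (auto simp: act_coprod_def)
  have fs: "f (action A s c) k = action A s (f c k)"
    if "s \<in> carrier S" "c \<in> carrier A" "k \<in> J" for s c k
    using f that by (auto simp: act_hom_def act_coprod_def)
  have f0: "f (basept A) k = basept A" if "k \<in> J" for k
    using f that by (auto simp: act_hom_def act_coprod_def)
  have fx: "f c \<in> extensional J" if "c \<in> carrier A" for c
    using fc[OF that] by (auto simp: act_coprod_def PiE_def)
  have supp: "\<exists>j\<in>J. \<forall>i\<in>J. i \<noteq> j \<longrightarrow> f c i = basept A" if c: "c \<in> carrier A" for c
  proof -
    obtain j where "\<forall>i\<in>J. i \<noteq> j \<longrightarrow> f c i = basept A"
      using fc[OF c] by (auto simp: act_coprod_def)
    then show ?thesis using J by (metis ex_in_conv)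
  qed
  have comp: "(\<lambda>c. f c k) \<in> act_hom S A A" if "k \<in> J" for k
    using that by (auto simp: act_hom_def fA fs f0)
  define r where "r k a = (if \<exists>m\<in>J. m \<noteq> k \<and> a m \<noteq> basept A
      then a (SOME m. m \<in> J \<and> m \<noteq> k \<and> a m \<noteq> basept A) else basept A)" for k :: 'j and a :: "'j \<Rightarrow> 'a"
  have r: "r k a = (if j = k then basept A else a j)"
    if "j \<in> J" "\<forall>i\<in>J. i \<noteq> j \<longrightarrow> a i = basept A" for j k a
  proof (cases "\<exists>m\<in>J. m \<noteq> k \<and> a m \<noteq> basept A")
    case True
    define m where "m = (SOME m. m \<in> J \<and> m \<noteq> k \<and> a m \<noteq> basept A)"
    have "m \<in> J \<and> m \<noteq> k \<and> a m \<noteq> basept A"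
      unfolding m_def by (rule someI_ex) (use True in blast)
    moreover from this have "m = j" using that(2) by blast
    moreover have "r k a = a m" using True by (simp add: r_def m_def)
    ultimately show ?thesis by simp
  next
    case False
    then have "r k a = basept A" unfolding r_def by (rule if_not_P)
    with False that(1) show ?thesis by auto
  qed
  define h where "h k c = (\<lambda>i\<in>{p, q}. if i = p then f c k else r k (f c))" for k c
  have h: "h k \<in> act_hom S A (act_coprod {p, q} (\<lambda>_. A))" if k: "k \<in> J" for k
  proof -
    have 1: "h k c \<in> carrier (act_coprod {p, q} (\<lambda>_. A))" if c: "c \<in> carrier A" for c
    proof -
      obtain j where j: "j \<in> J" "\<forall>i\<in>J. i \<noteq> j \<longrightarrow> f c i = basept A" using supp[OF c] by blast
      have "r k (f c) \<in> carrier A" using r[OF j, of k] fA[OF c j(1)] basept_closed by auto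
      moreover have "f c k = basept A \<or> r k (f c) = basept A" using r[OF j, of k] j(2) k by (cases "j = k") simp_all
      ultimately show ?thesis using pq fA[OF c k] by (auto simp: act_coprod_def h_def)
    qed
    have 2: "h k (action A s c) = action (act_coprod {p, q} (\<lambda>_. A)) s (h k c)"
      if s: "s \<in> carrier S" and c: "c \<in> carrier A" for s c
    proof -
      obtain j where j: "j \<in> J" "\<forall>i\<in>J. i \<noteq> j \<longrightarrow> f c i = basept A" using supp[OF c] by blast
      have j': "\<forall>i\<in>J. i \<noteq> j \<longrightarrow> f (action A s c) i = basept A"
        using j s c by (simp add: fs action_basept)
      have "r k (f (action A s c)) = action A s (r k (f c))"
        using r[OF j, of k] r[OF j(1) j', of k] fs[OF s c j(1)] action_basept[OF s] by simp
      then show ?thesis using fs[OF s c k] by (auto simp: act_coprod_def h_def restrict_def)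
    qed
    have 3: "h k (basept A) = basept (act_coprod {p, q} (\<lambda>_. A))"
      using f0 k by (auto simp: act_coprod_def h_def r_def restrict_def)
    show ?thesis using 1 2 3 by (auto simp: act_hom_def)
  qed
  have fact: "(\<forall>c\<in>carrier A. r k (f c) = basept A) \<or> (\<forall>c\<in>carrier A. f c k = basept A)"
    if k: "k \<in> J" for k
  proof -
    obtain i g where i: "i \<in> {p, q}"
      and g: "\<And>c. c \<in> carrier A \<Longrightarrow> h k c = act_inj {p, q} (\<lambda>_. A) i (g c)"
      using auto[unfolded autoconnected_def, rule_format, OF _ h[OF k]] by blast
    have "h k c p = (if p = i then g c else basept A)"
      "h k c q = (if q = i then g c else basept A)" if "c \<in> carrier A" for c
      using g[OF that] by (auto simp: act_inj_def)
    then show ?thesis using i pq by (auto simp: h_def)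
  qed
  show "\<exists>i\<in>J. \<exists>g\<in>act_hom S A A. \<forall>c\<in>carrier A. f c = act_inj J (\<lambda>_. A) i (g c)"
  proof -
    obtain k where k: "k \<in> J" "\<And>c m. c \<in> carrier A \<Longrightarrow> m \<in> J \<Longrightarrow> m \<noteq> k \<Longrightarrow> f c m = basept A"
    proof (cases "\<exists>k\<in>J. \<forall>c\<in>carrier A. r k (f c) = basept A")
      case True
      then obtain k where k: "k \<in> J" "\<forall>c\<in>carrier A. r k (f c) = basept A" by blast
      have "f c m = basept A" if "c \<in> carrier A" "m \<in> J" "m \<noteq> k" for c m
      proof -
        obtain j where j: "j \<in> J" "\<forall>i\<in>J. i \<noteq> j \<longrightarrow> f c i = basept A"
          using supp[OF \<open>c \<in> carrier A\<close>] by blast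
        have "j = k \<or> f c j = basept A" using r[OF j, of k] k(2) that(1) by (cases "j = k") simp_all
        with j(2) that show ?thesis by (cases "m = j") auto
      qed
      with k(1) that show ?thesis by blast
    next
      case False
      then have "f c k = basept A" if "c \<in> carrier A" "k \<in> J" for c k
        using fact that by blast
      with J that show ?thesis by blast
    qed
    have "f c = act_inj J (\<lambda>_. A) k (f c k)" if c: "c \<in> carrier A" for c
      using fx[OF c] k(2)[OF c] by (intro extensionalityI[of _ J]) (auto simp: act_inj_def)
    then show ?thesis
      by (intro bexI[OF _ k(1)] bexI[OF _ comp[OF k(1)]] ballI)
  qed
qed

end

theory Submission imports Defs begin

text \<open>
  Both conditions say that \<open>A\<close> has a morphism into a coproduct of two copies of itself that meets
  both summands outside zero.

  Such a morphism cannot factor through one summand. Conversely, a non-factoring morphism into an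
  arbitrary coproduct may be replaced by one into a coproduct indexed by the two booleans
  (\<open>autoconnected_index_type\<close>), where not factoring means that neither component is zero. This is
  \<open>not_autoconnected_iff_splits\<close>.

  An element of \<open>A1 \<squnion>\<^sub>a A2\<close> has at most one nonzero component. Hence the zero sets of the two
  components of a morphism \<open>u\<close> from \<open>A\<close> to \<open>A1 \<squnion>\<^sub>a A2\<close> are subacts covering \<open>A\<close>, proper when \<open>u\<close>
  meets both summands, and \<open>u\<close> composed with \<open>\<rho>\<close> is the morphism required in the second condition.
  In the other direction \<open>\<rho>\<close> is surjective because the two subacts cover \<open>A\<close>, so a morphism whose
  kernel contains that of \<open>\<rho>\<close> descends to \<open>A\<close>. This is \<open>splits_iff_subact_cover\<close>.
\<close>

section \<open>Morphisms meeting both summands\<close>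

definition splits :: "('s, 'm) monoid_scheme \<Rightarrow> ('s, 'a) act \<Rightarrow> ('s, 'b) act \<Rightarrow> ('s, 'c) act \<Rightarrow> bool"
  where "splits S X A B \<longleftrightarrow>
    (\<exists>u \<in> act_hom S X (A \<squnion>\<^sub>a B).
      (\<exists>x\<in>carrier X. fst (u x) \<noteq> basept A) \<and> (\<exists>x\<in>carrier X. snd (u x) \<noteq> basept B))"

lemma act_hom_coprod2_iff:
  "f \<in> act_hom S X (A \<squnion>\<^sub>a B) \<longleftrightarrow>
    fst \<circ> f \<in> act_hom S X A \<and> snd \<circ> f \<in> act_hom S X B \<and>
    (\<forall>x\<in>carrier X. fst (f x) = basept A \<or> snd (f x) = basept B)"
  by (auto simp: act_hom_def act_coprod2_def Pi_iff case_prod_beta prod_eq_iff)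

lemma splitsE:
  assumes "splits S X A B"
  obtains u where "u \<in> act_hom S X (A \<squnion>\<^sub>a B)"
    and "fst \<circ> u \<in> act_hom S X A" and "snd \<circ> u \<in> act_hom S X B"
    and "\<forall>x\<in>carrier X. fst (u x) = basept A \<or> snd (u x) = basept B"
    and "\<exists>x\<in>carrier X. fst (u x) \<noteq> basept A" and "\<exists>x\<in>carrier X. snd (u x) \<noteq> basept B"
proof -
  obtain u where "u \<in> act_hom S X (A \<squnion>\<^sub>a B)"
    and "\<exists>x\<in>carrier X. fst (u x) \<noteq> basept A" "\<exists>x\<in>carrier X. snd (u x) \<noteq> basept B"
    using assms unfolding splits_def by blast
  then show thesis using that act_hom_coprod2_iff[of u S X A B] by simp
qed

lemma act_hom_comp:
  "\<lbrakk>f \<in> act_hom S A B; g \<in> act_hom S B C\<rbrakk> \<Longrightarrow> g \<circ> f \<in> act_hom S A C"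
  by (auto simp: act_hom_def Pi_iff)

lemma act_isomorphic_sym: "act_isomorphic S A B \<Longrightarrow> act_isomorphic S B A"
  unfolding act_isomorphic_def by blast

text \<open>Injectivity makes composition with an isomorphism preserve nonvanishing of a component, which
  lets splitting be transported along isomorphisms.\<close>

lemma act_isomorphic_pointed:
  assumes "act_isomorphic S A B" and "basept A \<in> carrier A"
  obtains h where "h \<in> act_hom S A B"
    and "\<And>a. a \<in> carrier A \<Longrightarrow> h a = basept B \<longleftrightarrow> a = basept A"
proof -
  obtain h g where h: "h \<in> act_hom S A B" and gh: "\<And>a. a \<in> carrier A \<Longrightarrow> g (h a) = a"
    using assms(1) unfolding act_isomorphic_def by blast
  have "h (basept A) = basept B" using h by (simp add: act_hom_def)
  then have "h a = basept B \<longleftrightarrow> a = basept A" if "a \<in> carrier A" for a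
    using gh[OF that] gh[OF assms(2)] by metis
  with h show thesis by (rule that)
qed

lemma splits_isomorphic:
  assumes split: "splits S X A B"
    and "act_isomorphic S A A'" and "basept A \<in> carrier A"
    and "act_isomorphic S B B'" and "basept B \<in> carrier B"
  shows "splits S X A' B'"
proof -
  obtain h where h: "h \<in> act_hom S A A'"
    and h0: "\<And>a. a \<in> carrier A \<Longrightarrow> h a = basept A' \<longleftrightarrow> a = basept A"
    using act_isomorphic_pointed[OF assms(2,3)] by blast
  obtain k where k: "k \<in> act_hom S B B'"
    and k0: "\<And>b. b \<in> carrier B \<Longrightarrow> k b = basept B' \<longleftrightarrow> b = basept B"
    using act_isomorphic_pointed[OF assms(4,5)] by blast
  obtain u where u: "fst \<circ> u \<in> act_hom S X A" "snd \<circ> u \<in> act_hom S X B"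
      "\<forall>x\<in>carrier X. fst (u x) = basept A \<or> snd (u x) = basept B"
    and nz: "\<exists>x\<in>carrier X. fst (u x) \<noteq> basept A" "\<exists>x\<in>carrier X. snd (u x) \<noteq> basept B"
    using splitsE[OF split] by metis
  define v where "v x = (h (fst (u x)), k (snd (u x)))" for x
  have comps: "fst \<circ> v = h \<circ> (fst \<circ> u)" "snd \<circ> v = k \<circ> (snd \<circ> u)"
    by (auto simp: v_def)
  have mem: "fst (u x) \<in> carrier A" "snd (u x) \<in> carrier B" if "x \<in> carrier X" for x
    using u(1,2) that by (auto simp: act_hom_def Pi_iff)
  have "v \<in> act_hom S X (A' \<squnion>\<^sub>a B')"
    unfolding act_hom_coprod2_iff comps
    using act_hom_comp[OF u(1) h] act_hom_comp[OF u(2) k] u(3) mem h0 k0 by (simp add: v_def)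
  moreover have "\<exists>x\<in>carrier X. fst (v x) \<noteq> basept A'" "\<exists>x\<in>carrier X. snd (v x) \<noteq> basept B'"
    using nz mem h0 k0 by (auto simp: v_def)
  ultimately show ?thesis unfolding splits_def by blast
qed

section \<open>Autoconnectedness\<close>

text \<open>The boolean index type suffices: a one-element index set never obstructs factoring, and over
  both booleans a morphism with a vanishing component factors through the other summand.\<close>

lemma (in pointed_act) splits_if_not_autoconnected:
  assumes "\<not> autoconnected TYPE('i) S A"
  shows "splits S A A A"
proof -
  have two: "\<exists>p q :: bool. p \<noteq> q" by blast
  have "\<not> autoconnected TYPE(bool) S A"
    using assms by (rule contrapos_nn) (rule autoconnected_index_type[OF two])
  then obtain I :: "bool set" and f
    where I: "I \<noteq> {}" and f: "f \<in> act_hom S A (act_coprod I (\<lambda>_. A))"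
      and no_factor: "\<not> (\<exists>i\<in>I. \<exists>g\<in>act_hom S A A. \<forall>c\<in>carrier A. f c = act_inj I (\<lambda>_. A) i (g c))"
    unfolding autoconnected_def not_all not_imp ball_simps(10) by (elim exE conjE bexE) (rule that)
  have comp: "(\<lambda>c. f c i) \<in> act_hom S A A" if "i \<in> I" for i
    using f that by (auto simp: act_hom_def act_coprod_def Pi_iff)
  have ext: "f c \<in> extensional I" if "c \<in> carrier A" for c
    using f that by (auto simp: act_hom_def act_coprod_def Pi_iff PiE_def)
  have other: "\<exists>j\<in>I. j \<noteq> i \<and> (\<exists>c\<in>carrier A. f c j \<noteq> basept A)" if i: "i \<in> I" for i
  proof (rule ccontr)
    assume vanish: "\<not> ?thesis"
    have "f c = act_inj I (\<lambda>_. A) i (f c i)" if "c \<in> carrier A" for c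
      using ext[OF that] vanish that
      by (intro extensionalityI[of _ I]) (auto simp: act_inj_def)
    then show False
      using no_factor by (elim notE) (intro bexI[OF _ i] bexI[OF _ comp[OF i]] ballI)
  qed
  have I_full: "True \<in> I" "False \<in> I"
    using I other by (metis (full_types) all_not_in_conv)+
  define u where "u c = (f c True, f c False)" for c
  have comps: "fst \<circ> u = (\<lambda>c. f c True)" "snd \<circ> u = (\<lambda>c. f c False)"
    by (auto simp: u_def)
  have "f c True = basept A \<or> f c False = basept A" if "c \<in> carrier A" for c
  proof -
    have "f c \<in> carrier (act_coprod I (\<lambda>_. A))" using f that by (auto simp: act_hom_def)
    then obtain j where "\<forall>i\<in>I. i \<noteq> j \<longrightarrow> f c i = basept A" by (auto simp: act_coprod_def)
    then show ?thesis using I_full by (cases j) auto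
  qed
  then have "u \<in> act_hom S A (A \<squnion>\<^sub>a A)"
    unfolding act_hom_coprod2_iff comps using comp I_full by (simp add: u_def)
  moreover have "\<exists>c\<in>carrier A. fst (u c) \<noteq> basept A" "\<exists>c\<in>carrier A. snd (u c) \<noteq> basept A"
    using other[OF I_full(1)] other[OF I_full(2)] by (auto simp: u_def)
  ultimately show ?thesis unfolding splits_def by blast
qed

text \<open>Over the index set \<open>{p, q}\<close>, factoring through one summand would make the other component
  vanish identically.\<close>

lemma not_autoconnected_if_splits:
  fixes S :: "('s, 'm) monoid_scheme" and A :: "('s, 'a) act"
  assumes two: "\<exists>p q :: 'i. p \<noteq> q" and "splits S A A A"
  shows "\<not> autoconnected TYPE('i) S A"
proof
  assume auto: "autoconnected TYPE('i) S A"
  obtain p q :: 'i where pq: "p \<noteq> q" using two by blast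
  obtain u where u: "fst \<circ> u \<in> act_hom S A A" "snd \<circ> u \<in> act_hom S A A"
      "\<forall>x\<in>carrier A. fst (u x) = basept A \<or> snd (u x) = basept A"
    and nz: "\<exists>x\<in>carrier A. fst (u x) \<noteq> basept A" "\<exists>x\<in>carrier A. snd (u x) \<noteq> basept A"
    using splitsE[OF assms(2)] by metis
  define f where "f c = (\<lambda>i\<in>{p, q}. if i = p then fst (u c) else snd (u c))" for c
  have "f c \<in> carrier (act_coprod {p, q} (\<lambda>_. A))" if "c \<in> carrier A" for c
    using u that pq by (auto simp: f_def act_coprod_def act_hom_def Pi_iff)
  moreover have "f (action A s c) = action (act_coprod {p, q} (\<lambda>_. A)) s (f c)"
    if "s \<in> carrier S" "c \<in> carrier A" for s c
    using u(1,2) that by (auto simp: f_def act_coprod_def act_hom_def restrict_def)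
  moreover have "f (basept A) = basept (act_coprod {p, q} (\<lambda>_. A))"
    using u(1,2) by (auto simp: f_def act_coprod_def act_hom_def restrict_def)
  ultimately have f: "f \<in> act_hom S A (act_coprod {p, q} (\<lambda>_. A))"
    by (auto simp: act_hom_def)
  obtain i g where "i \<in> {p, q}"
    and g: "\<And>c. c \<in> carrier A \<Longrightarrow> f c = act_inj {p, q} (\<lambda>_. A) i (g c)"
    using auto[unfolded autoconnected_def, rule_format, OF _ f] by blast
  moreover have "f c p = fst (u c)" "f c q = snd (u c)" for c
    using pq by (auto simp: f_def)
  moreover have "f c p = (if p = i then g c else basept A)"
      "f c q = (if q = i then g c else basept A)" if "c \<in> carrier A" for c
    using g[OF that] by (auto simp: act_inj_def)
  ultimately show False
    using nz pq by (metis insertE singletonD)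
qed

lemma (in pointed_act) not_autoconnected_iff_splits:
  assumes "\<exists>p q :: 'i. p \<noteq> q"
  shows "\<not> autoconnected TYPE('i) S A \<longleftrightarrow> splits S A A A"
  using splits_if_not_autoconnected not_autoconnected_if_splits[OF assms] by blast

section \<open>Covers by two subacts\<close>

text \<open>A zero set is a subact because the zero of \<open>B\<close> is fixed by the action.\<close>

lemma (in pointed_act) subact_zero_set:
  assumes B: "pointed_act S z B" and g: "g \<in> act_hom S A B"
  shows "subact S A {a \<in> carrier A. g a = basept B}"
  using g action_closed basept_closed pointed_act.action_basept[OF B]
  by (auto simp: subact_def act_hom_def)

text \<open>The image contains zero, so it cannot differ from \<open>{0}\<close> by being empty.\<close>

lemma image_neq_zero_iff:
  assumes "g \<in> act_hom S X B" and "basept X \<in> carrier X"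
  shows "g ` carrier X \<noteq> {basept B} \<longleftrightarrow> (\<exists>x\<in>carrier X. g x \<noteq> basept B)"
proof -
  have "g (basept X) = basept B" using assms(1) by (simp add: act_hom_def)
  then have "basept B \<in> g ` carrier X" using assms(2) by (metis imageI)
  then show ?thesis by blast
qed

text \<open>Since the two subacts cover \<open>A\<close>, the morphism \<open>\<rho>\<close> presents \<open>A\<close> as a quotient of
  \<open>B1 \<squnion>\<^sub>a B2\<close>, and this is the universal property of that quotient. The section \<open>lift\<close> of \<open>\<rho>\<close>
  need not be a morphism, because an element of \<open>B2\<close> may be moved into \<open>B1\<close> by the action; but
  \<open>f\<close> does not see the difference.\<close>

lemma (in pointed_act) hom_descends_along_rho:
  assumes B: "subact S A B1" "subact S A B2" and cover: "carrier A = B1 \<union> B2"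
    and f: "f \<in> act_hom S (restrict_act A B1 \<squnion>\<^sub>a restrict_act A B2) C"
    and ker: "act_ker (restrict_act A B1 \<squnion>\<^sub>a restrict_act A B2) (act_rho A)
      \<subseteq> act_ker (restrict_act A B1 \<squnion>\<^sub>a restrict_act A B2) f"
  obtains u where "u \<in> act_hom S A C"
    and "\<And>p. p \<in> carrier (restrict_act A B1 \<squnion>\<^sub>a restrict_act A B2) \<Longrightarrow> u (act_rho A p) = f p"
proof -
  let ?P = "restrict_act A B1 \<squnion>\<^sub>a restrict_act A B2"
  have rho: "act_rho A \<in> act_hom S ?P A" using act_rho_hom[OF B] .
  define lift where
    "lift a = (if a \<in> B1 then act_inl (restrict_act A B2) a else act_inr (restrict_act A B1) a)" for a
  have lift: "lift a \<in> carrier ?P" "act_rho A (lift a) = a" if "a \<in> carrier A" for a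
    using that B cover
    by (auto simp: lift_def act_inl_def act_inr_def act_coprod2_def act_rho_def subact_def)
  have eq: "f p = f q" if "p \<in> carrier ?P" "q \<in> carrier ?P" "act_rho A p = act_rho A q" for p q
    using ker that by (auto simp: act_ker_def)
  have rho_mem: "act_rho A p \<in> carrier A" if "p \<in> carrier ?P" for p
    using rho that by (auto simp: act_hom_def)
  have desc: "f (lift (act_rho A p)) = f p" if "p \<in> carrier ?P" for p
    using lift[OF rho_mem[OF that]] that by (intro eq)
  have act_P: "action ?P s p \<in> carrier ?P" if "s \<in> carrier S" "p \<in> carrier ?P" for s p
    using that B action_basept by (auto simp: act_coprod2_def subact_def)
  have base_P: "basept ?P \<in> carrier ?P"
    using B by (auto simp: act_coprod2_def subact_def)
  have "f (lift a) \<in> carrier C" if "a \<in> carrier A" for a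
    using f lift(1)[OF that] by (auto simp: act_hom_def)
  moreover have "f (lift (action A s a)) = action C s (f (lift a))"
    if s: "s \<in> carrier S" and a: "a \<in> carrier A" for s a
  proof -
    have "act_rho A (action ?P s (lift a)) = action A s a"
      using rho s lift[OF a] by (simp add: act_hom_def)
    then have "f (lift (action A s a)) = f (action ?P s (lift a))"
      using desc[OF act_P[OF s lift(1)[OF a]]] by simp
    also have "\<dots> = action C s (f (lift a))"
      using f s lift(1)[OF a] by (simp add: act_hom_def)
    finally show ?thesis .
  qed
  moreover have "f (lift (basept A)) = basept C"
    using desc[OF base_P] rho f by (simp add: act_hom_def)
  ultimately have "f \<circ> lift \<in> act_hom S A C" by (simp add: act_hom_def)
  then show thesis using desc by (intro that[of "f \<circ> lift"]) simp_all
qed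

lemma (in pointed_act) splits_iff_subact_cover:
  fixes C :: "('s, 'c) act" and D :: "('s, 'd) act"
  assumes C: "pointed_act S z C" and D: "pointed_act S z D"
  shows "splits S A C D \<longleftrightarrow>
    (\<exists>B1 B2. subact S A B1 \<and> B1 \<noteq> carrier A \<and> subact S A B2 \<and> B2 \<noteq> carrier A \<and>
      carrier A = B1 \<union> B2 \<and>
      (\<exists>f \<in> act_hom S (restrict_act A B1 \<squnion>\<^sub>a restrict_act A B2) (C \<squnion>\<^sub>a D).
        (fst \<circ> f) ` carrier (restrict_act A B1 \<squnion>\<^sub>a restrict_act A B2) \<noteq> {basept C} \<and>
        (snd \<circ> f) ` carrier (restrict_act A B1 \<squnion>\<^sub>a restrict_act A B2) \<noteq> {basept D} \<and>
        act_ker (restrict_act A B1 \<squnion>\<^sub>a restrict_act A B2) (act_rho A)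
          \<subseteq> act_ker (restrict_act A B1 \<squnion>\<^sub>a restrict_act A B2) f))"
    (is "_ \<longleftrightarrow> ?cover")
proof
  assume split: "splits S A C D"
  obtain u where u: "u \<in> act_hom S A (C \<squnion>\<^sub>a D)"
    and comps: "fst \<circ> u \<in> act_hom S A C" "snd \<circ> u \<in> act_hom S A D"
      "\<forall>a\<in>carrier A. fst (u a) = basept C \<or> snd (u a) = basept D"
    and nz: "\<exists>a\<in>carrier A. fst (u a) \<noteq> basept C" "\<exists>a\<in>carrier A. snd (u a) \<noteq> basept D"
    using splitsE[OF split] by metis
  \<comment> \<open>The first subact is the part of \<open>A\<close> sent into \<open>C\<close>, where the second component vanishes.\<close>
  define B1 where "B1 = {a \<in> carrier A. (snd \<circ> u) a = basept D}"
  define B2 where "B2 = {a \<in> carrier A. (fst \<circ> u) a = basept C}"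
  let ?P = "restrict_act A B1 \<squnion>\<^sub>a restrict_act A B2"
  have sub: "subact S A B1" "subact S A B2"
    unfolding B1_def B2_def using subact_zero_set C D comps(1,2) by blast+
  have proper: "B1 \<noteq> carrier A" "B2 \<noteq> carrier A"
    using nz by (auto simp: B1_def B2_def)
  have cover: "carrier A = B1 \<union> B2"
    using comps(3) by (auto simp: B1_def B2_def)
  define f where "f = u \<circ> act_rho A"
  have f: "f \<in> act_hom S ?P (C \<squnion>\<^sub>a D)"
    unfolding f_def using act_hom_comp[OF act_rho_hom[OF sub] u] .
  have surj: "\<exists>p\<in>carrier ?P. act_rho A p = a" if "a \<in> carrier A" for a
  proof (cases "a \<in> B1")
    case True
    then have "act_inl (restrict_act A B2) a \<in> carrier ?P"
      using sub by (auto simp: act_inl_def act_coprod2_def subact_def)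
    then show ?thesis by (rule rev_bexI) (rule act_rho_inl)
  next
    case False
    then have "act_inr (restrict_act A B1) a \<in> carrier ?P"
      using sub cover that by (auto simp: act_inr_def act_coprod2_def subact_def)
    then show ?thesis by (rule rev_bexI) (rule act_rho_inr)
  qed
  obtain a b where "a \<in> carrier A" "fst (u a) \<noteq> basept C" "b \<in> carrier A" "snd (u b) \<noteq> basept D"
    using nz by blast
  moreover from this obtain p q where "p \<in> carrier ?P" "act_rho A p = a" "q \<in> carrier ?P" "act_rho A q = b"
    using surj by blast
  ultimately have "\<exists>p\<in>carrier ?P. (fst \<circ> f) p \<noteq> basept C" "\<exists>p\<in>carrier ?P. (snd \<circ> f) p \<noteq> basept D"
    by (auto simp: f_def)
  then have "(fst \<circ> f) ` carrier ?P \<noteq> {basept C}" "(snd \<circ> f) ` carrier ?P \<noteq> {basept D}"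
    by blast+
  moreover have "act_ker ?P (act_rho A) \<subseteq> act_ker ?P f"
    by (auto simp: act_ker_def f_def)
  ultimately show ?cover using sub proper cover f by (intro exI[of _ B1] exI[of _ B2] conjI bexI[of _ f])
next
  assume ?cover
  then obtain B1 B2 f where sub: "subact S A B1" "subact S A B2" and cover: "carrier A = B1 \<union> B2"
    and f: "f \<in> act_hom S (restrict_act A B1 \<squnion>\<^sub>a restrict_act A B2) (C \<squnion>\<^sub>a D)"
    and nz: "(fst \<circ> f) ` carrier (restrict_act A B1 \<squnion>\<^sub>a restrict_act A B2) \<noteq> {basept C}"
      "(snd \<circ> f) ` carrier (restrict_act A B1 \<squnion>\<^sub>a restrict_act A B2) \<noteq> {basept D}"
    and ker: "act_ker (restrict_act A B1 \<squnion>\<^sub>a restrict_act A B2) (act_rho A)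
      \<subseteq> act_ker (restrict_act A B1 \<squnion>\<^sub>a restrict_act A B2) f"
    by blast
  let ?P = "restrict_act A B1 \<squnion>\<^sub>a restrict_act A B2"
  obtain u where u: "u \<in> act_hom S A (C \<squnion>\<^sub>a D)"
    and uf: "\<And>p. p \<in> carrier ?P \<Longrightarrow> u (act_rho A p) = f p"
    using hom_descends_along_rho[OF sub cover f ker] by blast
  have base: "basept ?P \<in> carrier ?P"
    using sub by (auto simp: act_coprod2_def subact_def)
  have rho_mem: "act_rho A p \<in> carrier A" if "p \<in> carrier ?P" for p
    using act_rho_hom[OF sub] that by (auto simp: act_hom_def)
  have comps: "fst \<circ> f \<in> act_hom S ?P C" "snd \<circ> f \<in> act_hom S ?P D"
    using f unfolding act_hom_coprod2_iff by simp_all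
  obtain p q where p: "p \<in> carrier ?P" "fst (f p) \<noteq> basept C"
    and q: "q \<in> carrier ?P" "snd (f q) \<noteq> basept D"
    using nz unfolding image_neq_zero_iff[OF comps(1) base] image_neq_zero_iff[OF comps(2) base]
    by auto
  have "fst (u (act_rho A p)) \<noteq> basept C" "snd (u (act_rho A q)) \<noteq> basept D"
    using p(2) q(2) unfolding uf[OF p(1)] uf[OF q(1)] .
  then have "\<exists>a\<in>carrier A. fst (u a) \<noteq> basept C" "\<exists>a\<in>carrier A. snd (u a) \<noteq> basept D"
    using rho_mem[OF p(1)] rho_mem[OF q(1)] by blast+
  with u show "splits S A C D" unfolding splits_def by blast
qed

theorem proposition6p15:
  fixes S :: "('s, 'm) monoid_scheme" and z :: 's
    and A :: "('s, 'a) act" and A1 :: "('s, 'b) act" and A2 :: "('s, 'c) act"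
  assumes "monoid_with_zero S z"
    and "pointed_act S z A" and "pointed_act S z A1" and "pointed_act S z A2"
    and "act_isomorphic S A A1" and "act_isomorphic S A A2" and "act_isomorphic S A1 A2"
    and index_type: "\<exists>p q :: 'i. p \<noteq> q"
  shows "\<not> autoconnected TYPE('i) S A \<longleftrightarrow>
    (\<exists>B1 B2. subact S A B1 \<and> B1 \<noteq> carrier A \<and> subact S A B2 \<and> B2 \<noteq> carrier A \<and>
      carrier A = B1 \<union> B2 \<and>
      (\<exists>f \<in> act_hom S (restrict_act A B1 \<squnion>\<^sub>a restrict_act A B2) (A1 \<squnion>\<^sub>a A2).
        (fst \<circ> f) ` carrier (restrict_act A B1 \<squnion>\<^sub>a restrict_act A B2) \<noteq> {basept A1} \<and>
        (snd \<circ> f) ` carrier (restrict_act A B1 \<squnion>\<^sub>a restrict_act A B2) \<noteq> {basept A2} \<and>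
        act_ker (restrict_act A B1 \<squnion>\<^sub>a restrict_act A B2) (act_rho A)
          \<subseteq> act_ker (restrict_act A B1 \<squnion>\<^sub>a restrict_act A B2) f))"
proof -
  interpret pointed_act S z A by fact
  have base: "basept A1 \<in> carrier A1" "basept A2 \<in> carrier A2"
    using assms(3,4) by (simp_all add: pointed_act.basept_closed)
  have "splits S A A A \<longleftrightarrow> splits S A A1 A2"
    using splits_isomorphic[OF _ assms(5) basept_closed assms(6) basept_closed]
      splits_isomorphic[OF _ act_isomorphic_sym[OF assms(5)] base(1)
        act_isomorphic_sym[OF assms(6)] base(2)]
    by blast
  then show ?thesis
    using not_autoconnected_iff_splits[OF index_type] splits_iff_subact_cover[OF assms(3,4)]
    by simp
qed

end
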